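(* Let $\mathbb{F}=\mathbb{R}$ or $\mathbb{C}$. The vector space $\Sigma$ (with addition $\boxplus$) with the Lie bracket $$[\langle A\rangle,\langle B\rangle]:=\langle A\rangle\ltimes\langle B\rangle\boxminus\langle B\rangle\ltimes\langle A\rangle$$ is a bundled Lie algebra (denoted $gl(\mathbb{F})$), with respect to the discrete bundle $(\mathcal{M}_1,\mathrm{Pr},\Sigma)$ with leaves $\mathcal{M}_{n\times n}$, $n=1,2,\dots$.
   Context: $\mathcal{M}_1=\bigcup_{n\ge1}\mathcal{M}_{n\times n}$ is the set of all square matrices over $\mathbb{F}$; $\otimes$ is the Kronecker product. $A\sim B$ means $A\otimes I_s=B\otimes I_t$ for some positive integers $s,t$; $\Sigma:=\mathcal{M}_1/\!\sim$ with classes $\langle A\rangle$, and $\mathrm{Pr}(A)=\langle A\rangle$. For $A\in\mathcal{M}_{m\times m}$, $B\in\mathcal{M}_{n\times n}$, $t=\mathrm{lcm}(m,n)$: $\langle A\rangle\boxplus\langle B\rangle:=\langle A\otimes I_{t/m}+B\otimes I_{t/n}\rangle$, $\langle A\rangle\boxminus\langle B\rangle:=\langle A\otimes I_{t/m}-B\otimes I_{t/n}\rangle$, $\langle A\rangle\ltimes\langle B\rangle:=\langle(A\otimes I_{t/m})(B\otimes I_{t/n})\rangle$, $a\langle A\rangle:=\langle aA\rangle$; these are well defined and make $\Sigma$ a vector space over $\mathbb{F}$. A bundle is a triple $(E,p,B)$ with $E,B$ topological spaces and $p:E\to B$ continuous; here $\mathcal{M}_1$ has the topology in which each $\mathcal{M}_{n\times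 n}$ is clopen with its Euclidean topology, and $\Sigma$ has the topology generated by the sub-basis of all sets $s_n(o):=\{\langle A\rangle:\langle A\rangle\cap o\ne\emptyset\}$, $n\ge1$, $o$ an open ball in $\mathcal{M}_{n\times n}$ with rational center and radius. The bundle is called discrete because each fiber $\mathrm{Pr}^{-1}(\langle A\rangle)=\{A_1,A_1\otimes I_2,A_1\otimes I_3,\dots\}$ is a discrete set ($A_1$ being the unique element of $\langle A\rangle$ not of the form $B\otimes I_s$, $s\ge2$). Bundled Lie algebra: let $(E,\mathrm{Pr},B)$ be a discrete bundle with leaves $E_i$, $i=1,2,\dots$. $B$ is a bundled Lie algebra if (1) $B$ is a Lie algebra; (2) each $E_i$ is a Lie algebra; (3) each restriction $\mathrm{Pr}|_{E_i}:E_i\to B$ is a Lie algebra homomorphism. Here the leaf $\mathcal{M}_{n\times n}$ has the Lie algebra structure $gl(n,\mathbb{F})$ with the commutator bracket.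
   Formalization: Pr is not continuous for the topology on Σ generated by the sets s_n(o), so for it all parts of the claim except continuity of Pr are stated; the full claim, with Pr continuous, is stated with the quotient topology on Σ instead. *)

theory Defs
  imports
    "HOL-Analysis.Abstract_Metric_Spaces"
    "HOL-Analysis.L2_Norm"
    "HOL-Analysis.Function_Topology"
    "Jordan_Normal_Form.VS_Connect"
begin

section \<open>Lie algebras\<close>

record ('k, 'v) lie_struct = "('k, 'v) module" +
  bracket :: "'v \<Rightarrow> 'v \<Rightarrow> 'v"

text \<open>
  A record of type \<^typ>\<open>('k, 'v) lie_struct\<close> inherits \<^const>\<open>monoid.mult\<close> and
  \<^const>\<open>monoid.one\<close> from the module record; as for modules, these fields play no role.
\<close>

locale lie_algebra = vectorspace K L
  for K :: "('k, 'm) ring_scheme" and L :: "('k, 'v, 'l) lie_struct_scheme" +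
  assumes bracket_closed:
      "\<lbrakk>x \<in> carrier L; y \<in> carrier L\<rbrakk> \<Longrightarrow> bracket L x y \<in> carrier L"
    and bracket_add_left:
      "\<lbrakk>x \<in> carrier L; y \<in> carrier L; z \<in> carrier L\<rbrakk> \<Longrightarrow>
        bracket L (x \<oplus>\<^bsub>L\<^esub> y) z = bracket L x z \<oplus>\<^bsub>L\<^esub> bracket L y z"
    and bracket_add_right:
      "\<lbrakk>x \<in> carrier L; y \<in> carrier L; z \<in> carrier L\<rbrakk> \<Longrightarrow>
        bracket L x (y \<oplus>\<^bsub>L\<^esub> z) = bracket L x y \<oplus>\<^bsub>L\<^esub> bracket L x z"
    and bracket_smult_left:
      "\<lbrakk>a \<in> carrier K; x \<in> carrier L; y \<in> carrier L\<rbrakk> \<Longrightarrow>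
        bracket L (a \<odot>\<^bsub>L\<^esub> x) y = a \<odot>\<^bsub>L\<^esub> bracket L x y"
    and bracket_smult_right:
      "\<lbrakk>a \<in> carrier K; x \<in> carrier L; y \<in> carrier L\<rbrakk> \<Longrightarrow>
        bracket L x (a \<odot>\<^bsub>L\<^esub> y) = a \<odot>\<^bsub>L\<^esub> bracket L x y"
    and bracket_alternating:
      "x \<in> carrier L \<Longrightarrow> bracket L x x = \<zero>\<^bsub>L\<^esub>"
    and jacobi:
      "\<lbrakk>x \<in> carrier L; y \<in> carrier L; z \<in> carrier L\<rbrakk> \<Longrightarrow>
        bracket L x (bracket L y z) \<oplus>\<^bsub>L\<^esub> bracket L y (bracket L z x)
          \<oplus>\<^bsub>L\<^esub> bracket L z (bracket L x y) = \<zero>\<^bsub>L\<^esub>"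

locale lie_algebra_hom =
  V: lie_algebra K V + W: lie_algebra K W + linear_map K V W f
  for K :: "('k, 'm) ring_scheme" and V :: "('k, 'v, 'l) lie_struct_scheme"
    and W :: "('k, 'w, 'n) lie_struct_scheme" and f +
  assumes hom_bracket:
    "\<lbrakk>x \<in> carrier V; y \<in> carrier V\<rbrakk> \<Longrightarrow> f (bracket V x y) = bracket W (f x) (f y)"


section \<open>Bundles\<close>

definition top_bundle :: "'e topology \<Rightarrow> ('e \<Rightarrow> 'b) \<Rightarrow> 'b topology \<Rightarrow> bool" where
  "top_bundle E p B \<longleftrightarrow> continuous_map E B p"

definition fiber :: "'e topology \<Rightarrow> ('e \<Rightarrow> 'b) \<Rightarrow> 'b \<Rightarrow> 'e set" where
  "fiber E p b = {x \<in> topspace E. p x = b}"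

definition discrete_fibers :: "'e topology \<Rightarrow> ('e \<Rightarrow> 'b) \<Rightarrow> 'b topology \<Rightarrow> bool" where
  "discrete_fibers E p B \<longleftrightarrow>
    (\<forall>b \<in> topspace B. subtopology E (fiber E p b) = discrete_topology (fiber E p b))"

definition discrete_bundle :: "'e topology \<Rightarrow> ('e \<Rightarrow> 'b) \<Rightarrow> 'b topology \<Rightarrow> bool" where
  "discrete_bundle E p B \<longleftrightarrow> top_bundle E p B \<and> discrete_fibers E p B"

definition leaves :: "'e topology \<Rightarrow> 'i set \<Rightarrow> ('i \<Rightarrow> 'e set) \<Rightarrow> bool" where
  "leaves E I F \<longleftrightarrow>
    (\<Union>i\<in>I. F i) = topspace E \<and> disjoint_family_on F I \<and>
    (\<forall>i\<in>I. openin E (F i) \<and> closedin E (F i))"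

text \<open>
  The part of the notion of a bundled Lie algebra that concerns the Lie structures:
  the leaves are the carriers of \<open>L i\<close>, the base is the carrier of \<open>V\<close>, and
  (1) the base is a Lie algebra, (2) every leaf is a Lie algebra, (3) \<open>p\<close> restricts on every
  leaf to a Lie algebra homomorphism.
\<close>

definition bundled_lie_structure ::
  "('k, 'm) ring_scheme \<Rightarrow> 'e topology \<Rightarrow> ('e \<Rightarrow> 'b) \<Rightarrow> 'b topology \<Rightarrow> 'i set \<Rightarrow>
    ('i \<Rightarrow> ('k, 'e) lie_struct) \<Rightarrow> ('k, 'b) lie_struct \<Rightarrow> bool" where
  "bundled_lie_structure K E p B I L V \<longleftrightarrow>
    leaves E I (\<lambda>i. carrier (L i)) \<and> carrier V = topspace B \<and>
    lie_algebra K V \<and>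
    (\<forall>i\<in>I. lie_algebra K (L i)) \<and>
    (\<forall>i\<in>I. lie_algebra_hom K (L i) V p)"

definition bundled_lie_algebra ::
  "('k, 'm) ring_scheme \<Rightarrow> 'e topology \<Rightarrow> ('e \<Rightarrow> 'b) \<Rightarrow> 'b topology \<Rightarrow> 'i set \<Rightarrow>
    ('i \<Rightarrow> ('k, 'e) lie_struct) \<Rightarrow> ('k, 'b) lie_struct \<Rightarrow> bool" where
  "bundled_lie_algebra K E p B I L V \<longleftrightarrow>
    discrete_bundle E p B \<and> bundled_lie_structure K E p B I L V"


section \<open>Square matrices of all sizes modulo \<open>\<sim>\<close>\<close>

definition kronecker :: "'a::semiring_1 mat \<Rightarrow> 'a mat \<Rightarrow> 'a mat" (infixl \<open>\<otimes>\<^sub>K\<close> 70) where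
  "A \<otimes>\<^sub>K B = mat (dim_row A * dim_row B) (dim_col A * dim_col B)
    (\<lambda>(i, j). A $$ (i div dim_row B, j div dim_col B) * B $$ (i mod dim_row B, j mod dim_col B))"

definition square_mats :: "'a mat set" where
  "square_mats = (\<Union>n\<in>{1..}. carrier_mat n n)"

definition mat_sim :: "('a::semiring_1 mat \<times> 'a mat) set" where
  "mat_sim = {(A, B). A \<in> square_mats \<and> B \<in> square_mats \<and>
    (\<exists>s t. s > 0 \<and> t > 0 \<and> A \<otimes>\<^sub>K 1\<^sub>m s = B \<otimes>\<^sub>K 1\<^sub>m t)}"

definition Sigma_space :: "'a::semiring_1 mat set set" where
  "Sigma_space = square_mats // mat_sim"

definition Pr :: "'a::semiring_1 mat \<Rightarrow> 'a mat set" where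
  "Pr A = mat_sim `` {A}"

text \<open>Expansion of a square matrix to size \<open>t\<close>, a multiple of its own size.\<close>

definition expand :: "nat \<Rightarrow> 'a::semiring_1 mat \<Rightarrow> 'a mat" where
  "expand t A = A \<otimes>\<^sub>K 1\<^sub>m (t div dim_row A)"

text \<open>
  The operations on classes are unions over all representatives. That such a union is
  again a single class, as the closure axioms of a Lie algebra demand, says precisely that the
  operation does not depend on the representatives.
\<close>

definition sigma_op ::
  "('a::semiring_1 mat \<Rightarrow> 'a mat \<Rightarrow> 'a mat) \<Rightarrow> 'a mat set \<Rightarrow> 'a mat set \<Rightarrow> 'a mat set" where
  "sigma_op f X Y = (\<Union>A\<in>X. \<Union>B\<in>Y. let t = lcm (dim_row A) (dim_row B) in
    Pr (f (expand t A) (expand t B)))"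

definition sigma_add :: "'a::ring_1 mat set \<Rightarrow> 'a mat set \<Rightarrow> 'a mat set" (infixl \<open>\<boxplus>\<close> 65)
  where "sigma_add = sigma_op (+)"

definition sigma_minus :: "'a::ring_1 mat set \<Rightarrow> 'a mat set \<Rightarrow> 'a mat set" (infixl \<open>\<boxminus>\<close> 65)
  where "sigma_minus = sigma_op (-)"

definition sigma_mult :: "'a::ring_1 mat set \<Rightarrow> 'a mat set \<Rightarrow> 'a mat set" (infixl \<open>\<ltimes>\<close> 70)
  where "sigma_mult = sigma_op (*)"

definition sigma_smult :: "'a::ring_1 \<Rightarrow> 'a mat set \<Rightarrow> 'a mat set"
  where "sigma_smult a X = (\<Union>A\<in>X. Pr (a \<cdot>\<^sub>m A))"

definition gl_leaf :: "nat \<Rightarrow> ('a::field, 'a mat) lie_struct" where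
  "gl_leaf n = module.extend (module_mat TYPE('a) n n)
    (lie_struct.fields (\<lambda>A B. A * B - B * A))"

definition gl_sigma :: "('a::field, 'a mat set) lie_struct" where
  "gl_sigma = \<lparr>
    carrier = Sigma_space,
    mult = (\<ltimes>),
    one = Pr (1\<^sub>m 1),
    zero = Pr (0\<^sub>m 1 1),
    add = (\<boxplus>),
    smult = sigma_smult,
    bracket = (\<lambda>X Y. (X \<ltimes> Y) \<boxminus> (Y \<ltimes> X))\<rparr>"


section \<open>Topologies\<close>

definition mat_dist :: "nat \<Rightarrow> 'a::metric_space mat \<Rightarrow> 'a mat \<Rightarrow> real" where
  "mat_dist n A B = L2_set (\<lambda>ij. dist (A $$ ij) (B $$ ij)) ({..<n} \<times> {..<n})"

abbreviation mat_ball :: "nat \<Rightarrow> 'a::metric_space mat \<Rightarrow> real \<Rightarrow> 'a mat set" where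
  "mat_ball n \<equiv> Metric_space.mball (carrier_mat n n) (mat_dist n)"

abbreviation euclidean_mat_topology :: "nat \<Rightarrow> 'a::metric_space mat topology" where
  "euclidean_mat_topology n \<equiv> Metric_space.mtopology (carrier_mat n n) (mat_dist n)"

definition matrix_topology :: "'a::metric_space mat topology" where
  "matrix_topology = topology (\<lambda>U. U \<subseteq> square_mats \<and>
    (\<forall>n\<ge>1. openin (euclidean_mat_topology n) (U \<inter> carrier_mat n n)))"

text \<open>
  For real entries \<open>Basis = {1}\<close>, for complex entries \<open>Basis = {1, \<i>}\<close>; so a matrix is rational
  if its entries, respectively their real and imaginary parts, are rational.
\<close>

definition rational_mat :: "nat \<Rightarrow> 'a::euclidean_space mat \<Rightarrow> bool" where
  "rational_mat n C \<longleftrightarrow> C \<in> carrier_mat n n \<and>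
    (\<forall>i<n. \<forall>j<n. \<forall>b\<in>Basis. C $$ (i, j) \<bullet> b \<in> \<rat>)"

definition sigma_nbhd :: "'a::semiring_1 mat set \<Rightarrow> 'a mat set set" where
  "sigma_nbhd U = {X \<in> Sigma_space. X \<inter> U \<noteq> {}}"

definition sigma_topology :: "'a::{euclidean_space, real_normed_field} mat set topology" where
  "sigma_topology = topology_generated_by
    {sigma_nbhd (mat_ball n C r) | n C r. n \<ge> 1 \<and> rational_mat n C \<and> r \<in> \<rat> \<and> r > 0}"

definition sigma_quotient_topology ::
    "'a::{euclidean_space, real_normed_field} mat set topology" where
  "sigma_quotient_topology =
    topology (\<lambda>U. U \<subseteq> Sigma_space \<and> openin matrix_topology {A \<in> square_mats. Pr A \<in> U})"

lemma kronecker_dim [simp]: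
  "dim_row (A \<otimes>\<^sub>K B) = dim_row A * dim_row B"
  "dim_col (A \<otimes>\<^sub>K B) = dim_col A * dim_col B"
  by (simp_all add: kronecker_def)

lemma kronecker_index [simp]:
  "\<lbrakk>i < dim_row A * dim_row B; j < dim_col A * dim_col B\<rbrakk> \<Longrightarrow> (A \<otimes>\<^sub>K B) $$ (i, j) =
    A $$ (i div dim_row B, j div dim_col B) * B $$ (i mod dim_row B, j mod dim_col B)"
  by (simp add: kronecker_def)

lemma kronecker_zero: "0\<^sub>m m n \<otimes>\<^sub>K B = 0\<^sub>m (m * dim_row B) (n * dim_col B)"
  by (rule eq_matI) (simp_all add: less_mult_imp_div_less)

lemma Metric_space_mat: "Metric_space (carrier_mat n n) (mat_dist n)"
proof
  fix A B C :: "'a mat"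
  show "0 \<le> mat_dist n A B" by (simp add: mat_dist_def)
  show "mat_dist n A B = mat_dist n B A" by (simp add: mat_dist_def dist_commute)
  assume AB: "A \<in> carrier_mat n n" "B \<in> carrier_mat n n"
  show "mat_dist n A B = 0 \<longleftrightarrow> A = B"
    using AB by (auto simp: mat_dist_def L2_set_eq_0_iff intro!: eq_matI)
  show "mat_dist n A C \<le> mat_dist n A B + mat_dist n B C"
  proof -
    have "mat_dist n A C \<le>
        L2_set (\<lambda>ij. dist (A $$ ij) (B $$ ij) + dist (B $$ ij) (C $$ ij)) ({..<n} \<times> {..<n})"
      unfolding mat_dist_def by (intro L2_set_mono) (auto intro: dist_triangle)
    also have "\<dots> \<le> mat_dist n A B + mat_dist n B C"
      unfolding mat_dist_def by (rule L2_set_triangle_ineq)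
    finally show ?thesis .
  qed
qed

lemma openin_matrix_topology:
  "openin matrix_topology U \<longleftrightarrow> U \<subseteq> square_mats \<and>
    (\<forall>n\<ge>1. openin (euclidean_mat_topology n) (U \<inter> carrier_mat n n))"
proof -
  have "istopology (\<lambda>U :: 'a mat set. U \<subseteq> square_mats \<and>
    (\<forall>n\<ge>1. openin (euclidean_mat_topology n) (U \<inter> carrier_mat n n)))"
    unfolding istopology_def
  proof (intro conjI allI impI)
    fix S T :: "'a mat set" and n :: nat
    assume "S \<subseteq> square_mats \<and> (\<forall>n\<ge>1. openin (euclidean_mat_topology n) (S \<inter> carrier_mat n n))"
      "T \<subseteq> square_mats \<and> (\<forall>n\<ge>1. openin (euclidean_mat_topology n) (T \<inter> carrier_mat n n))" "1 \<le> n"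
    then have "openin (euclidean_mat_topology n) ((S \<inter> carrier_mat n n) \<inter> (T \<inter> carrier_mat n n))"
      by blast
    moreover have "(S \<inter> carrier_mat n n) \<inter> (T \<inter> carrier_mat n n) = S \<inter> T \<inter> carrier_mat n n"
      by blast
    ultimately show "openin (euclidean_mat_topology n) (S \<inter> T \<inter> carrier_mat n n)" by simp
  next
    fix \<K> :: "'a mat set set" and n :: nat
    assume "\<forall>K\<in>\<K>. K \<subseteq> square_mats \<and>
      (\<forall>n\<ge>1. openin (euclidean_mat_topology n) (K \<inter> carrier_mat n n))" "1 \<le> n"
    then have "openin (euclidean_mat_topology n) (\<Union>K\<in>\<K>. K \<inter> carrier_mat n n)"
      by blast
    moreover have "(\<Union>K\<in>\<K>. K \<inter> carrier_mat n n) = \<Union>\<K> \<inter> carrier_mat n n"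
      by blast
    ultimately show "openin (euclidean_mat_topology n) (\<Union>\<K> \<inter> carrier_mat n n)" by simp
  next
    fix \<K> :: "'a mat set set"
    assume "\<forall>K\<in>\<K>. K \<subseteq> square_mats \<and>
      (\<forall>n\<ge>1. openin (euclidean_mat_topology n) (K \<inter> carrier_mat n n))"
    then show "\<Union>\<K> \<subseteq> square_mats"
      by (intro Union_least) simp
  qed (simp add: le_infI1)
  then show ?thesis
    by (simp add: matrix_topology_def topology_inverse')
qed

text \<open>
  The projection is not continuous for \<^const>\<open>sigma_topology\<close>: the preimage in the leaf of
  size 2 of the classes meeting the unit ball of the leaf of size 1 consists of scalar matrices.
  It is continuous for \<^const>\<open>sigma_quotient_topology\<close>, by definition of the latter.
\<close>

lemma not_bundle_sigma_topology:
  "\<not> top_bundle matrix_topology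
      (Pr :: 'a::{euclidean_space, real_normed_field} mat \<Rightarrow> 'a mat set) sigma_topology"
proof
  assume "top_bundle matrix_topology (Pr :: 'a mat \<Rightarrow> 'a mat set) sigma_topology"
  then have cont: "continuous_map matrix_topology sigma_topology (Pr :: 'a mat \<Rightarrow> 'a mat set)"
    by (simp add: top_bundle_def)
  interpret M1: Metric_space "carrier_mat 1 1" "mat_dist 1 :: 'a mat \<Rightarrow> 'a mat \<Rightarrow> real"
    by (rule Metric_space_mat)
  interpret M2: Metric_space "carrier_mat 2 2" "mat_dist 2 :: 'a mat \<Rightarrow> 'a mat \<Rightarrow> real"
    by (rule Metric_space_mat)
  define Z1 Z2 :: "'a mat" where "Z1 = 0\<^sub>m 1 1" and "Z2 = 0\<^sub>m 2 2"
  define U where "U = sigma_nbhd (mat_ball 1 Z1 1)"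
  define P where "P = {A \<in> topspace matrix_topology. Pr A \<in> U}"
  have sq: "carrier_mat n n \<subseteq> (square_mats :: 'a mat set)" if "n \<ge> 1" for n
    using that unfolding square_mats_def by blast
  have "openin sigma_topology U"
    unfolding sigma_topology_def U_def
    by (rule topology_generated_by_Basis) (force simp: rational_mat_def Z1_def)
  then have "openin matrix_topology P"
    unfolding P_def by (rule openin_continuous_map_preimage[OF cont])
  then have op: "openin M2.mtopology (P \<inter> carrier_mat 2 2)"
    by (simp add: openin_matrix_topology)
  have top: "topspace matrix_topology = (square_mats :: 'a mat set)"
  proof
    show "topspace matrix_topology \<subseteq> (square_mats :: 'a mat set)"
      by (metis openin_matrix_topology openin_topspace)
    have "openin matrix_topology (square_mats :: 'a mat set)"
    proof -
      have "openin (euclidean_mat_topology n) ((square_mats :: 'a mat set) \<inter> carrier_mat n n)"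
        if "n \<ge> 1" for n
      proof -
        interpret Metric_space "carrier_mat n n" "mat_dist n :: 'a mat \<Rightarrow> 'a mat \<Rightarrow> real"
          by (rule Metric_space_mat)
        have "(square_mats :: 'a mat set) \<inter> carrier_mat n n = topspace mtopology"
          using sq[OF that] by auto
        then show ?thesis by (metis openin_topspace)
      qed
      then show ?thesis by (simp add: openin_matrix_topology)
    qed
    then show "(square_mats :: 'a mat set) \<subseteq> topspace matrix_topology"
      by (rule openin_subset)
  qed
  have Z: "Z1 \<in> square_mats" "Z2 \<in> square_mats"
    using sq[of 1] sq[of 2] by (auto simp: Z1_def Z2_def)
  have "Z2 \<otimes>\<^sub>K 1\<^sub>m 1 = Z1 \<otimes>\<^sub>K 1\<^sub>m 2"
    by (simp add: Z1_def Z2_def kronecker_zero)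
  moreover have "(1::nat) > 0" "(2::nat) > 0" by simp_all
  ultimately have "(Z2, Z1) \<in> mat_sim"
    unfolding mat_sim_def using Z by blast
  moreover have "Z1 \<in> mat_ball 1 Z1 1"
    unfolding M1.in_mball by (simp add: Z1_def mat_dist_def L2_set_def)
  ultimately have "Pr Z2 \<inter> mat_ball 1 Z1 1 \<noteq> {}"
    unfolding Pr_def by blast
  moreover have "Pr Z2 \<in> Sigma_space"
    unfolding Pr_def Sigma_space_def using Z by (simp add: quotientI)
  ultimately have "Z2 \<in> P \<inter> carrier_mat 2 2"
    using Z unfolding P_def U_def sigma_nbhd_def top by (simp add: Z2_def)
  then obtain r where r: "r > 0" "M2.mball Z2 r \<subseteq> P \<inter> carrier_mat 2 2"
    using op unfolding M2.openin_mtopology by blast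
  define N :: "'a mat" where
    "N = mat 2 2 (\<lambda>(i, j). if i = 0 \<and> j = 1 then of_real (r / 2) else 0)"
  have "mat_dist 2 Z2 N \<le> r / 2"
  proof -
    have "mat_dist 2 Z2 N \<le> (\<Sum>ij\<in>{..<2} \<times> {..<2}. dist (Z2 $$ ij) (N $$ ij))"
      unfolding mat_dist_def by (rule L2_set_le_sum) simp
    also have "{..<2::nat} \<times> {..<2::nat} = {(0, 0), (0, 1), (1, 0), (1, 1)}"
      by (auto simp: less_2_cases_iff)
    also have "(\<Sum>ij\<in>{(0, 0), (0, 1), (1, 0), (1, 1)}. dist (Z2 $$ ij) (N $$ ij)) = r / 2"
      using r(1) by (simp add: Z2_def N_def)
    finally show ?thesis .
  qed
  then have "N \<in> M2.mball Z2 r"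
    using r(1) by (simp add: Z2_def N_def)
  then have "N \<in> P" using r(2) by blast
  then obtain B where B: "B \<in> carrier_mat 1 1" "(N, B) \<in> mat_sim"
    unfolding P_def U_def sigma_nbhd_def Pr_def using M1.mball_subset_mspace by blast
  then obtain s t where st: "s > 0" "t > 0" "N \<otimes>\<^sub>K 1\<^sub>m s = B \<otimes>\<^sub>K 1\<^sub>m t"
    unfolding mat_sim_def by auto
  have "dim_row (N \<otimes>\<^sub>K 1\<^sub>m s) = dim_row (B \<otimes>\<^sub>K 1\<^sub>m t)"
    using st(3) by simp
  then have t: "t = 2 * s"
    using B(1) by (simp add: kronecker_def N_def)
  have "(N \<otimes>\<^sub>K 1\<^sub>m s) $$ (0, s) = of_real (r / 2)"
    using st(1) by (simp add: N_def)
  moreover have "(B \<otimes>\<^sub>K 1\<^sub>m t) $$ (0, s) = 0"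
    using st(1) B(1) by (simp add: t)
  ultimately show False using st(3) r(1) by simp
qed

end

(*
  Compatibility with A \<mapsto> A \<otimes> I_s makes every operation on classes computable on representatives
  of one common size, and any three classes have such representatives. So Sigma is the directed
  union of the images of the Lie algebras gl(n), on each of which Pr is an injective homomorphism,
  and every Lie algebra axiom, involving at most three elements, is inherited from some gl(n).
  Injectivity of Pr on each leaf also gives discreteness: a fiber meets each (open) leaf in at
  most one point.
*)

theory Submission
  imports Defs
begin

section \<open>Kronecker products with identity matrices\<close>

lemma kronecker_one_carrier [simp]:
  "A \<in> carrier_mat m n \<Longrightarrow> A \<otimes>\<^sub>K 1\<^sub>m s \<in> carrier_mat (m * s) (n * s)"
  by (intro carrier_matI) auto

text \<open>Resolves the delta of the identity factor; the positivity of \<open>s\<close> that this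
  requires follows from the index bounds. Most later entrywise proofs use this form with
  \<open>kronecker_index\<close> deleted.\<close>

lemma kronecker_one_index:
  assumes "i < dim_row A * s" "j < dim_col A * s"
  shows "(A \<otimes>\<^sub>K 1\<^sub>m s) $$ (i, j) = (if i mod s = j mod s then A $$ (i div s, j div s) else 0)"
proof -
  have "s > 0" using assms by (cases s) auto
  then show ?thesis using assms by simp
qed

lemma kronecker_one_one: "A \<otimes>\<^sub>K 1\<^sub>m 1 = A"
  by (rule eq_matI) (simp_all add: kronecker_one_index)

text \<open>This is I_s \<otimes> I_t = I_(st), read off entry by entry.\<close>

lemma kronecker_one_assoc: "(A \<otimes>\<^sub>K 1\<^sub>m s) \<otimes>\<^sub>K 1\<^sub>m t = A \<otimes>\<^sub>K 1\<^sub>m (s * t)"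
proof (rule eq_matI)
  fix i j assume "i < dim_row (A \<otimes>\<^sub>K 1\<^sub>m (s * t))" "j < dim_col (A \<otimes>\<^sub>K 1\<^sub>m (s * t))"
  then have ij: "i < dim_row A * (s * t)" "j < dim_col A * (s * t)" by simp_all
  then have i: "i < dim_row A * s * t" "i div t < dim_row A * s"
    and j: "j < dim_col A * s * t" "j div t < dim_col A * s"
    by (simp_all add: mult.assoc less_mult_imp_div_less)
  \<comment> \<open>A remainder mod \<open>s * t\<close> is a pair of mixed-radix digits: the low
    digit mod \<open>t\<close> and the high digit \<open>(i div t) mod s\<close>.\<close>
  have "i mod (s * t) = j mod (s * t) \<longleftrightarrow> i mod t = j mod t \<and> (i div t) mod s = (j div t) mod s"
    (is "?l \<longleftrightarrow> ?r")
  proof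
    assume l: ?l
    have "i mod (s * t) mod t = j mod (s * t) mod t" using l by simp
    then have "i mod t = j mod t" by (simp add: mod_mod_cancel)
    \<comment> \<open>\<open>ij(1)\<close> forces \<open>t > 0\<close>, so the factor
      \<open>t\<close> in front of the high digits cancels.\<close>
    with l show ?r using ij(1) by (auto simp: mult.commute[of s] mod_mult2_eq)
  qed (simp add: mult.commute[of s] mod_mult2_eq)
  then show "((A \<otimes>\<^sub>K 1\<^sub>m s) \<otimes>\<^sub>K 1\<^sub>m t) $$ (i, j) = (A \<otimes>\<^sub>K 1\<^sub>m (s * t)) $$ (i, j)"
    using ij i j by (simp add: kronecker_one_index mult.commute[of s] div_mult2_eq del: kronecker_index)
qed (simp_all add: mult.assoc)

text \<open>The top left corner of block (i, j) of an expansion, at position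
  \<open>(i * s, j * s)\<close>, is the original entry.\<close>

lemma kronecker_one_cancel:
  assumes "A \<in> carrier_mat m n" "B \<in> carrier_mat m n" "s > 0" "A \<otimes>\<^sub>K 1\<^sub>m s = B \<otimes>\<^sub>K 1\<^sub>m s"
  shows "A = B"
proof (rule eq_matI)
  fix i j assume ij: "i < dim_row B" "j < dim_col B"
  with assms(1,2) have "i < dim_row A" "j < dim_col A" by auto
  with ij have *: "i * s < dim_row A * s" "i * s < dim_row B * s"
    "j * s < dim_col A * s" "j * s < dim_col B * s"
    using assms(3) by simp_all
  have "(A \<otimes>\<^sub>K 1\<^sub>m s) $$ (i * s, j * s) = (B \<otimes>\<^sub>K 1\<^sub>m s) $$ (i * s, j * s)"
    using assms(4) by simp
  then show "A $$ (i, j) = B $$ (i, j)"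
    using * assms(3) by (simp add: kronecker_one_index del: kronecker_index)
qed (use assms in auto)

lemma kronecker_one_add:
  assumes "A \<in> carrier_mat m n" "B \<in> carrier_mat m n"
  shows "A \<otimes>\<^sub>K 1\<^sub>m s + B \<otimes>\<^sub>K 1\<^sub>m s = (A + B) \<otimes>\<^sub>K 1\<^sub>m s"
  using assms
  by (intro eq_matI) (auto simp: kronecker_one_index less_mult_imp_div_less simp del: kronecker_index)

lemma kronecker_one_minus:
  fixes A :: "'a::ring_1 mat"
  assumes "A \<in> carrier_mat m n" "B \<in> carrier_mat m n"
  shows "A \<otimes>\<^sub>K 1\<^sub>m s - B \<otimes>\<^sub>K 1\<^sub>m s = (A - B) \<otimes>\<^sub>K 1\<^sub>m s"
  using assms
  by (intro eq_matI) (auto simp: kronecker_one_index less_mult_imp_div_less simp del: kronecker_index)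

lemma kronecker_one_smult: "a \<cdot>\<^sub>m (A \<otimes>\<^sub>K 1\<^sub>m s) = (a \<cdot>\<^sub>m A) \<otimes>\<^sub>K 1\<^sub>m s"
  by (intro eq_matI) (auto simp: kronecker_one_index less_mult_imp_div_less simp del: kronecker_index)

text \<open>Mixed-product rule with identity factors: only middle indices congruent to
  \<open>i\<close> mod \<open>s\<close> contribute, and these correspond to the summation range of
  the small product.\<close>

lemma kronecker_one_mult:
  assumes A: "A \<in> carrier_mat l m" and B: "B \<in> carrier_mat m n"
  shows "(A \<otimes>\<^sub>K 1\<^sub>m s) * (B \<otimes>\<^sub>K 1\<^sub>m s) = (A * B) \<otimes>\<^sub>K 1\<^sub>m s"
proof (rule eq_matI)
  fix i j
  assume "i < dim_row ((A * B) \<otimes>\<^sub>K 1\<^sub>m s)" "j < dim_col ((A * B) \<otimes>\<^sub>K 1\<^sub>m s)"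
  then have ij: "i < l * s" "j < n * s" using A B by auto
  then have s: "s > 0" by (cases s) auto
  have dims: "dim_row A = l" "dim_col A = m" "dim_row B = m" "dim_col B = n" using A B by auto
  \<comment> \<open>\<open>c k\<close> is the contribution of block index \<open>k\<close>. Once
    \<open>k mod s = i mod s\<close> holds for the large index, the delta of the second factor
    becomes a condition on \<open>i\<close> and \<open>j\<close> alone.\<close>
  define c where "c k = (if i mod s = j mod s then A $$ (i div s, k) * B $$ (k, j div s) else 0)" for k
  have div: "i div s < l" "j div s < n" using ij by (simp_all add: less_mult_imp_div_less)
  have lt: "k * s + i mod s < m * s" if "k < m" for k
  proof -
    have "k * s + i mod s < Suc k * s" using s by simp
    also have "\<dots> \<le> m * s" using that by (intro mult_le_mono1) simp
    finally show ?thesis .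
  qed
  have "((A \<otimes>\<^sub>K 1\<^sub>m s) * (B \<otimes>\<^sub>K 1\<^sub>m s)) $$ (i, j) =
      (\<Sum>k<m * s. (A \<otimes>\<^sub>K 1\<^sub>m s) $$ (i, k) * (B \<otimes>\<^sub>K 1\<^sub>m s) $$ (k, j))"
    using ij by (simp add: scalar_prod_def dims lessThan_atLeast0 del: kronecker_index)
  also have "\<dots> = (\<Sum>k<m * s. if k mod s = i mod s then c (k div s) else 0)"
    using ij by (intro sum.cong)
      (auto simp: c_def dims kronecker_one_index simp del: kronecker_index)
  also have "\<dots> = (\<Sum>k\<in>{k \<in> {..<m * s}. k mod s = i mod s}. c (k div s))"
    by (rule sum.inter_filter[symmetric]) simp
  also have "\<dots> = (\<Sum>k<m. c k)"
  \<comment> \<open>Block \<open>k\<close> contains exactly one index with remainder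
    \<open>i mod s\<close>, namely \<open>k * s + i mod s\<close>; \<open>lt\<close> keeps it in
    range.\<close>
  proof (rule sum.reindex_bij_witness[where i = "\<lambda>k. k * s + i mod s" and j = "\<lambda>k. k div s"])
    fix k assume k: "k \<in> {k \<in> {..<m * s}. k mod s = i mod s}"
    then have "k mod s = i mod s" by simp
    then show "k div s * s + i mod s = k" using div_mult_mod_eq[of k s] by simp
  qed (use s lt in \<open>auto simp: less_mult_imp_div_less\<close>)
  also have "\<dots> = ((A * B) \<otimes>\<^sub>K 1\<^sub>m s) $$ (i, j)"
    using ij div by (simp add: c_def kronecker_one_index dims scalar_prod_def lessThan_atLeast0
        del: kronecker_index)
  finally show "((A \<otimes>\<^sub>K 1\<^sub>m s) * (B \<otimes>\<^sub>K 1\<^sub>m s)) $$ (i, j) = ((A * B) \<otimes>\<^sub>K 1\<^sub>m s) $$ (i, j)" .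
qed (use A B in auto)


section \<open>Classes of matrices\<close>

lemma square_mats_iff: "A \<in> square_mats \<longleftrightarrow> dim_col A = dim_row A \<and> dim_row A > 0"
  unfolding square_mats_def carrier_mat_def by auto

lemma carrier_mat_square_mats: "A \<in> carrier_mat n n \<Longrightarrow> n > 0 \<Longrightarrow> A \<in> square_mats"
  by (simp add: square_mats_iff)

lemma kronecker_one_square_mats: "A \<in> square_mats \<Longrightarrow> s > 0 \<Longrightarrow> A \<otimes>\<^sub>K 1\<^sub>m s \<in> square_mats"
  by (auto simp: square_mats_iff)

lemma mat_simI:
  "\<lbrakk>A \<in> square_mats; B \<in> square_mats; s > 0; t > 0; A \<otimes>\<^sub>K 1\<^sub>m s = B \<otimes>\<^sub>K 1\<^sub>m t\<rbrakk> \<Longrightarrow> (A, B) \<in> mat_sim"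
  unfolding mat_sim_def by blast

lemma mat_simE:
  assumes "(A, B) \<in> mat_sim"
  obtains s t where "A \<in> square_mats" "B \<in> square_mats" "s > 0" "t > 0" "A \<otimes>\<^sub>K 1\<^sub>m s = B \<otimes>\<^sub>K 1\<^sub>m t"
  using assms unfolding mat_sim_def by blast

lemma equiv_mat_sim: "equiv square_mats mat_sim"
proof (rule equivI)
  show "mat_sim \<subseteq> square_mats \<times> (square_mats :: 'a::semiring_1 mat set)"
    by (auto simp: mat_sim_def)
  show "refl_on square_mats (mat_sim :: ('a mat \<times> _) set)"
    by (rule refl_onI) (rule mat_simI[where s = 1 and t = 1], auto)
  show "sym (mat_sim :: ('a mat \<times> _) set)"
    by (rule symI) (metis mat_simE mat_simI)
  show "trans (mat_sim :: ('a mat \<times> _) set)"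
  proof (rule transI)
    fix A B C :: "'a mat"
    assume "(A, B) \<in> mat_sim" "(B, C) \<in> mat_sim"
    then obtain s t u v where *: "A \<in> square_mats" "C \<in> square_mats" "s > 0" "t > 0" "u > 0" "v > 0"
      "A \<otimes>\<^sub>K 1\<^sub>m s = B \<otimes>\<^sub>K 1\<^sub>m t" "B \<otimes>\<^sub>K 1\<^sub>m u = C \<otimes>\<^sub>K 1\<^sub>m v"
      by (elim mat_simE) blast
    \<comment> \<open>Expanding the first relation by \<open>u\<close> and the second by
      \<open>t\<close> gives both the same middle term
      \<open>B \<otimes>\<^sub>K 1\<^sub>m (t * u)\<close>.\<close>
    have "A \<otimes>\<^sub>K 1\<^sub>m (s * u) = B \<otimes>\<^sub>K 1\<^sub>m (t * u)"
      by (simp only: kronecker_one_assoc[symmetric] *)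
    also have "\<dots> = C \<otimes>\<^sub>K 1\<^sub>m (v * t)"
      by (simp only: kronecker_one_assoc[symmetric] * mult.commute[of t])
    finally have "A \<otimes>\<^sub>K 1\<^sub>m (s * u) = C \<otimes>\<^sub>K 1\<^sub>m (v * t)" .
    then show "(A, C) \<in> mat_sim" using * by (intro mat_simI[where s = "s * u" and t = "v * t"]) auto
  qed
qed

lemma Pr_eq_iff:
  "A \<in> square_mats \<Longrightarrow> B \<in> square_mats \<Longrightarrow> Pr A = Pr B \<longleftrightarrow> (A, B) \<in> mat_sim"
  unfolding Pr_def by (rule eq_equiv_class_iff[OF equiv_mat_sim])

lemma mem_Pr_iff: "A \<in> square_mats \<Longrightarrow> B \<in> Pr A \<longleftrightarrow> B \<in> square_mats \<and> Pr B = Pr A"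
  by (metis Pr_def Pr_eq_iff Image_singleton_iff mat_simE)

lemma self_mem_Pr: "A \<in> square_mats \<Longrightarrow> A \<in> Pr A"
  by (simp add: mem_Pr_iff)

lemma Pr_in_Sigma_space: "A \<in> square_mats \<Longrightarrow> Pr A \<in> Sigma_space"
  unfolding Pr_def Sigma_space_def by (rule quotientI)

lemma Sigma_spaceE:
  assumes "X \<in> Sigma_space"
  obtains A where "A \<in> square_mats" "X = Pr A"
  using assms unfolding Sigma_space_def Pr_def by (rule quotientE)

lemma Pr_kronecker_one:
  assumes "A \<in> square_mats" "s > 0"
  shows "Pr (A \<otimes>\<^sub>K 1\<^sub>m s) = Pr A"
proof -
  have "(A \<otimes>\<^sub>K 1\<^sub>m s, A) \<in> mat_sim"
    using assms by (intro mat_simI[where s = 1 and t = s])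
      (auto intro: kronecker_one_square_mats simp: kronecker_one_one)
  then show ?thesis
    using assms by (simp add: Pr_eq_iff kronecker_one_square_mats)
qed

text \<open>Divisibility makes the quotient in \<open>expand\<close> exact, so the result has size
  exactly \<open>t\<close>.\<close>

lemma Pr_expand:
  assumes "A \<in> square_mats" "dim_row A dvd t" "t > 0"
  shows "Pr (expand t A) = Pr A" "expand t A \<in> carrier_mat t t"
proof -
  from assms(2) obtain k where t: "t = dim_row A * k" ..
  have k: "t div dim_row A = k" "k > 0" using assms(1,3) t by (auto simp: square_mats_iff)
  show "Pr (expand t A) = Pr A" unfolding expand_def k using assms(1) k(2) by (rule Pr_kronecker_one)
  show "expand t A \<in> carrier_mat t t"
    using assms(1) by (intro carrier_matI) (simp_all add: expand_def k(1) t square_mats_iff)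
qed

text \<open>Equal sizes force equal expansion factors in the relation, and a common factor
  cancels.\<close>

lemma Pr_inj_on_leaf:
  assumes "A \<in> carrier_mat n n" "B \<in> carrier_mat n n" "n > 0" "Pr A = Pr B"
  shows "A = B"
proof -
  have "(A, B) \<in> mat_sim"
    using assms by (simp add: Pr_eq_iff carrier_mat_square_mats)
  then obtain s t where st: "s > 0" "A \<otimes>\<^sub>K 1\<^sub>m s = B \<otimes>\<^sub>K 1\<^sub>m t" by (rule mat_simE)
  from st(2) have "dim_row (A \<otimes>\<^sub>K 1\<^sub>m s) = dim_row (B \<otimes>\<^sub>K 1\<^sub>m t)" by simp
  with assms have "s = t" by auto
  with st show ?thesis using kronecker_one_cancel assms(1,2) by blast
qed

text \<open>The product of the three sizes is a common multiple to which all representatives expand.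
  Three classes are what associativity, distributivity and the Jacobi identity demand.\<close>

lemma common_representatives:
  assumes "X \<in> Sigma_space" "Y \<in> Sigma_space" "Z \<in> Sigma_space"
  obtains n A B C where "n > 0" "A \<in> carrier_mat n n" "B \<in> carrier_mat n n" "C \<in> carrier_mat n n"
    "X = Pr A" "Y = Pr B" "Z = Pr C"
proof -
  obtain A where A: "A \<in> square_mats" "X = Pr A" using assms(1) by (rule Sigma_spaceE)
  obtain B where B: "B \<in> square_mats" "Y = Pr B" using assms(2) by (rule Sigma_spaceE)
  obtain C where C: "C \<in> square_mats" "Z = Pr C" using assms(3) by (rule Sigma_spaceE)
  define t where "t = dim_row A * dim_row B * dim_row C"
  have t: "t > 0" "dim_row A dvd t" "dim_row B dvd t" "dim_row C dvd t"
    using A B C by (auto simp: t_def square_mats_iff)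
  show thesis
    using that[of t "expand t A" "expand t B" "expand t C"] t A B C by (simp add: Pr_expand)
qed

section \<open>Operations on classes, computed on representatives\<close>

lemma Pr_eq_imp_kronecker_one_eq:
  assumes "m > 0" "n > 0" "A \<in> carrier_mat m m" "B \<in> carrier_mat n n" "Pr A = Pr B"
  shows "A \<otimes>\<^sub>K 1\<^sub>m n = B \<otimes>\<^sub>K 1\<^sub>m m"
proof (rule Pr_inj_on_leaf)
  \<comment> \<open>Both sides represent one class in the leaf of size \<open>m * n\<close>, where
    \<open>Pr\<close> is injective. The unspecified factors of the relation are thereby replaced by
    explicit ones.\<close>
  show "A \<otimes>\<^sub>K 1\<^sub>m n \<in> carrier_mat (m * n) (m * n)" using assms by simp
  show "B \<otimes>\<^sub>K 1\<^sub>m m \<in> carrier_mat (m * n) (m * n)"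
    using kronecker_one_carrier[OF assms(4)] by (simp add: mult.commute)
  show "Pr (A \<otimes>\<^sub>K 1\<^sub>m n) = Pr (B \<otimes>\<^sub>K 1\<^sub>m m)"
    using assms by (simp add: Pr_kronecker_one carrier_mat_square_mats)
qed (use assms in simp)

text \<open>An operation that preserves size and commutes with expansion descends to classes;
  \<open>+\<close>, \<open>-\<close> and \<open>*\<close> are all treated by this one
  criterion.\<close>

lemma sigma_op_Pr:
  assumes closed: "\<And>m A B. A \<in> carrier_mat m m \<Longrightarrow> B \<in> carrier_mat m m \<Longrightarrow> f A B \<in> carrier_mat m m"
    and f: "\<And>m s A B. A \<in> carrier_mat m m \<Longrightarrow> B \<in> carrier_mat m m \<Longrightarrow>
      f (A \<otimes>\<^sub>K 1\<^sub>m s) (B \<otimes>\<^sub>K 1\<^sub>m s) = f A B \<otimes>\<^sub>K 1\<^sub>m s"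
    and "n > 0" "A \<in> carrier_mat n n" "B \<in> carrier_mat n n"
  shows "sigma_op f (Pr A) (Pr B) = Pr (f A B)"
proof -
  have sq: "A \<in> square_mats" "B \<in> square_mats" using assms by (auto intro: carrier_mat_square_mats)
  have eq: "(let t = lcm (dim_row A') (dim_row B') in Pr (f (expand t A') (expand t B'))) = Pr (f A B)"
    if "A' \<in> Pr A" "B' \<in> Pr B" for A' B'
  proof -
    define t where "t = lcm (dim_row A') (dim_row B')"
    have A'B': "A' \<in> square_mats" "B' \<in> square_mats" "Pr A' = Pr A" "Pr B' = Pr B"
      using that sq by (simp_all add: mem_Pr_iff)
    then have t: "t > 0" "dim_row A' dvd t" "dim_row B' dvd t"
      by (auto simp: t_def square_mats_iff lcm_pos_nat)
    define C D where "C = expand t A'" and "D = expand t B'"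
    have C: "C \<in> carrier_mat t t" "Pr C = Pr A" and D: "D \<in> carrier_mat t t" "Pr D = Pr B"
      unfolding C_def D_def using A'B' t by (simp_all add: Pr_expand)
    \<comment> \<open>\<open>C\<close> and \<open>D\<close> have size \<open>t\<close> while
      \<open>A\<close> and \<open>B\<close> have size \<open>n\<close>, so the comparison takes
      place in size \<open>t * n\<close>.\<close>
    have CD: "C \<otimes>\<^sub>K 1\<^sub>m n = A \<otimes>\<^sub>K 1\<^sub>m t" "D \<otimes>\<^sub>K 1\<^sub>m n = B \<otimes>\<^sub>K 1\<^sub>m t"
      using Pr_eq_imp_kronecker_one_eq[OF t(1) assms(3)] C D assms(4,5) by blast+
    have "Pr (f C D) = Pr (f C D \<otimes>\<^sub>K 1\<^sub>m n)"
      using closed[OF C(1) D(1)] t(1) assms(3) by (simp add: Pr_kronecker_one carrier_mat_square_mats)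
    also have "\<dots> = Pr (f A B \<otimes>\<^sub>K 1\<^sub>m t)"
      using f[OF C(1) D(1)] f[OF assms(4,5)] CD by metis
    also have "\<dots> = Pr (f A B)"
      using closed[OF assms(4,5)] t(1) assms(3)
      by (simp add: Pr_kronecker_one carrier_mat_square_mats)
    finally show ?thesis by (simp add: t_def C_def D_def Let_def)
  qed
  \<comment> \<open>By \<open>eq\<close> the union runs over a constant family; the pair
    \<open>A\<close>, \<open>B\<close> itself makes it nonempty.\<close>
  show ?thesis
    unfolding sigma_op_def using self_mem_Pr[OF sq(1)] self_mem_Pr[OF sq(2)] by (force simp: eq)
qed

context
  fixes n :: nat and A B :: "'a::field mat"
  assumes n: "n > 0" and A: "A \<in> carrier_mat n n" and B: "B \<in> carrier_mat n n"
begin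

lemma sigma_add_Pr: "Pr A \<boxplus> Pr B = Pr (A + B)"
  unfolding sigma_add_def by (rule sigma_op_Pr[OF _ _ n A B]) (auto simp: kronecker_one_add)

lemma sigma_minus_Pr: "Pr A \<boxminus> Pr B = Pr (A - B)"
  unfolding sigma_minus_def by (rule sigma_op_Pr[OF _ _ n A B]) (auto simp: kronecker_one_minus)

lemma sigma_mult_Pr: "Pr A \<ltimes> Pr B = Pr (A * B)"
  unfolding sigma_mult_def by (rule sigma_op_Pr[OF _ _ n A B]) (auto simp: kronecker_one_mult)

end

text \<open>Scaling commutes with expansion, so all representatives contribute the same class to the
  union.\<close>

lemma sigma_smult_Pr:
  fixes A :: "'a::field mat"
  assumes A: "A \<in> square_mats"
  shows "sigma_smult a (Pr A) = Pr (a \<cdot>\<^sub>m A)"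
proof -
  have "Pr (a \<cdot>\<^sub>m B) = Pr (a \<cdot>\<^sub>m A)" if "B \<in> Pr A" for B
  proof -
    have "(A, B) \<in> mat_sim" using that by (simp add: Pr_def)
    then obtain s t where st: "B \<in> square_mats" "s > 0" "t > 0" "A \<otimes>\<^sub>K 1\<^sub>m s = B \<otimes>\<^sub>K 1\<^sub>m t"
      by (rule mat_simE)
    have sq: "a \<cdot>\<^sub>m A \<in> square_mats" "a \<cdot>\<^sub>m B \<in> square_mats"
      using A st(1) by (auto simp: square_mats_iff)
    have "(a \<cdot>\<^sub>m A) \<otimes>\<^sub>K 1\<^sub>m s = (a \<cdot>\<^sub>m B) \<otimes>\<^sub>K 1\<^sub>m t"
      by (metis kronecker_one_smult st(4))
    then show ?thesis by (metis Pr_kronecker_one sq st(2,3))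
  qed
  then show ?thesis
    unfolding sigma_smult_def using self_mem_Pr[OF A] by blast
qed

section \<open>The Lie algebras\<close>

text \<open>Closure and identities pass to images under homomorphisms. By directedness any three
  elements of \<open>V\<close> lie in the image of a single \<open>L i\<close>, where the required
  law is available.\<close>

lemma lie_algebra_directed_union:
  fixes V :: "('k, 'v, 'l) lie_struct_scheme" and L :: "'i \<Rightarrow> ('k, 'e, 'm) lie_struct_scheme"
  assumes L: "\<And>i. i \<in> I \<Longrightarrow> lie_algebra K (L i)"
    and closed: "\<And>i x. \<lbrakk>i \<in> I; x \<in> carrier (L i)\<rbrakk> \<Longrightarrow> p x \<in> carrier V"
    and add: "\<And>i x y. \<lbrakk>i \<in> I; x \<in> carrier (L i); y \<in> carrier (L i)\<rbrakk> \<Longrightarrow>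
      p x \<oplus>\<^bsub>V\<^esub> p y = p (x \<oplus>\<^bsub>L i\<^esub> y)"
    and smult: "\<And>i a x. \<lbrakk>i \<in> I; a \<in> carrier K; x \<in> carrier (L i)\<rbrakk> \<Longrightarrow>
      a \<odot>\<^bsub>V\<^esub> p x = p (a \<odot>\<^bsub>L i\<^esub> x)"
    and bracket: "\<And>i x y. \<lbrakk>i \<in> I; x \<in> carrier (L i); y \<in> carrier (L i)\<rbrakk> \<Longrightarrow>
      bracket V (p x) (p y) = p (bracket (L i) x y)"
    and zero: "\<And>i. i \<in> I \<Longrightarrow> \<zero>\<^bsub>V\<^esub> = p \<zero>\<^bsub>L i\<^esub>"
    and "I \<noteq> {}"
    and directed: "\<And>x y z. \<lbrakk>x \<in> carrier V; y \<in> carrier V; z \<in> carrier V\<rbrakk> \<Longrightarrow>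
      \<exists>i\<in>I. {x, y, z} \<subseteq> p ` carrier (L i)"
  shows "lie_algebra K V"
proof -
  \<comment> \<open>An arbitrary member of the family: it shows that the zero of \<open>V\<close>
    lies in the carrier and supplies the field axioms of \<open>K\<close>.\<close>
  obtain i0 where i0: "i0 \<in> I" using \<open>I \<noteq> {}\<close> by blast
  interpret L0: lie_algebra K "L i0" using L[OF i0] .
  have zero_closed: "\<zero>\<^bsub>V\<^esub> \<in> carrier V"
    using zero[OF i0] closed[OF i0 L0.M.zero_closed] by simp
  \<comment> \<open>All laws without scalars are stated for a full triple, so that one choice of
    \<open>i\<close> and of preimages serves them all.\<close>
  have group: "x \<oplus>\<^bsub>V\<^esub> y \<in> carrier V" "x \<oplus>\<^bsub>V\<^esub> y \<oplus>\<^bsub>V\<^esub> z = x \<oplus>\<^bsub>V\<^esub> (y \<oplus>\<^bsub>V\<^esub> z)"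
      "x \<oplus>\<^bsub>V\<^esub> y = y \<oplus>\<^bsub>V\<^esub> x" "\<zero>\<^bsub>V\<^esub> \<oplus>\<^bsub>V\<^esub> x = x" "\<exists>y\<in>carrier V. y \<oplus>\<^bsub>V\<^esub> x = \<zero>\<^bsub>V\<^esub>"
      "bracket V x y \<in> carrier V"
      "bracket V (x \<oplus>\<^bsub>V\<^esub> y) z = bracket V x z \<oplus>\<^bsub>V\<^esub> bracket V y z"
      "bracket V x (y \<oplus>\<^bsub>V\<^esub> z) = bracket V x y \<oplus>\<^bsub>V\<^esub> bracket V x z"
      "bracket V x x = \<zero>\<^bsub>V\<^esub>"
      "bracket V x (bracket V y z) \<oplus>\<^bsub>V\<^esub> bracket V y (bracket V z x)
          \<oplus>\<^bsub>V\<^esub> bracket V z (bracket V x y) = \<zero>\<^bsub>V\<^esub>"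
    if "x \<in> carrier V" "y \<in> carrier V" "z \<in> carrier V" for x y z
  proof -
    from directed[OF that] obtain i where i: "i \<in> I"
      and "x \<in> p ` carrier (L i)" "y \<in> p ` carrier (L i)" "z \<in> p ` carrier (L i)" by auto
    then obtain x' y' z' where xyz: "x = p x'" "y = p y'" "z = p z'"
      and c: "x' \<in> carrier (L i)" "y' \<in> carrier (L i)" "z' \<in> carrier (L i)"
      by (elim imageE)
    interpret Li: lie_algebra K "L i" using L[OF i] .
    note hom = xyz c closed[OF i] add[OF i] bracket[OF i] zero[OF i] Li.bracket_closed
    show "x \<oplus>\<^bsub>V\<^esub> y \<in> carrier V" by (simp add: hom)
    show "x \<oplus>\<^bsub>V\<^esub> y \<oplus>\<^bsub>V\<^esub> z = x \<oplus>\<^bsub>V\<^esub> (y \<oplus>\<^bsub>V\<^esub> z)" by (simp add: hom Li.M.a_assoc)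
    show "x \<oplus>\<^bsub>V\<^esub> y = y \<oplus>\<^bsub>V\<^esub> x" by (simp add: hom Li.M.a_comm)
    show "\<zero>\<^bsub>V\<^esub> \<oplus>\<^bsub>V\<^esub> x = x" by (simp add: hom)
    show "\<exists>y\<in>carrier V. y \<oplus>\<^bsub>V\<^esub> x = \<zero>\<^bsub>V\<^esub>"
      \<comment> \<open>The negative of \<open>x\<close> is the image of the negative of its
        preimage.\<close>
      by (rule bexI[of _ "p (\<ominus>\<^bsub>L i\<^esub> x')"]) (simp_all add: hom Li.M.l_neg)
    show "bracket V x y \<in> carrier V" by (simp add: hom)
    show "bracket V (x \<oplus>\<^bsub>V\<^esub> y) z = bracket V x z \<oplus>\<^bsub>V\<^esub> bracket V y z"
      by (simp add: hom Li.bracket_add_left)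
    show "bracket V x (y \<oplus>\<^bsub>V\<^esub> z) = bracket V x y \<oplus>\<^bsub>V\<^esub> bracket V x z"
      by (simp add: hom Li.bracket_add_right)
    show "bracket V x x = \<zero>\<^bsub>V\<^esub>" by (simp add: hom Li.bracket_alternating)
    show "bracket V x (bracket V y z) \<oplus>\<^bsub>V\<^esub> bracket V y (bracket V z x)
          \<oplus>\<^bsub>V\<^esub> bracket V z (bracket V x y) = \<zero>\<^bsub>V\<^esub>"
      by (simp add: hom Li.jacobi)
  qed
  have scalars: "a \<odot>\<^bsub>V\<^esub> x \<in> carrier V"
      "(a \<oplus>\<^bsub>K\<^esub> b) \<odot>\<^bsub>V\<^esub> x = a \<odot>\<^bsub>V\<^esub> x \<oplus>\<^bsub>V\<^esub> b \<odot>\<^bsub>V\<^esub> x"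
      "a \<odot>\<^bsub>V\<^esub> (x \<oplus>\<^bsub>V\<^esub> y) = a \<odot>\<^bsub>V\<^esub> x \<oplus>\<^bsub>V\<^esub> a \<odot>\<^bsub>V\<^esub> y"
      "(a \<otimes>\<^bsub>K\<^esub> b) \<odot>\<^bsub>V\<^esub> x = a \<odot>\<^bsub>V\<^esub> (b \<odot>\<^bsub>V\<^esub> x)" "\<one>\<^bsub>K\<^esub> \<odot>\<^bsub>V\<^esub> x = x"
      "bracket V (a \<odot>\<^bsub>V\<^esub> x) y = a \<odot>\<^bsub>V\<^esub> bracket V x y"
      "bracket V x (a \<odot>\<^bsub>V\<^esub> y) = a \<odot>\<^bsub>V\<^esub> bracket V x y"
    if ab: "a \<in> carrier K" "b \<in> carrier K" and xy: "x \<in> carrier V" "y \<in> carrier V" for a b x y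
  proof -
    from directed[OF xy xy(2)] obtain i where i: "i \<in> I"
      and "x \<in> p ` carrier (L i)" "y \<in> p ` carrier (L i)" by auto
    then obtain x' y' where xy: "x = p x'" "y = p y'"
      and c: "x' \<in> carrier (L i)" "y' \<in> carrier (L i)" by (elim imageE)
    interpret Li: lie_algebra K "L i" using L[OF i] .
    note hom = ab xy c closed[OF i] add[OF i] smult[OF i] bracket[OF i] Li.bracket_closed
    show "a \<odot>\<^bsub>V\<^esub> x \<in> carrier V" by (simp add: hom)
    show "(a \<oplus>\<^bsub>K\<^esub> b) \<odot>\<^bsub>V\<^esub> x = a \<odot>\<^bsub>V\<^esub> x \<oplus>\<^bsub>V\<^esub> b \<odot>\<^bsub>V\<^esub> x" by (simp add: hom Li.smult_l_distr)
    show "a \<odot>\<^bsub>V\<^esub> (x \<oplus>\<^bsub>V\<^esub> y) = a \<odot>\<^bsub>V\<^esub> x \<oplus>\<^bsub>V\<^esub> a \<odot>\<^bsub>V\<^esub> y" by (simp add: hom Li.smult_r_distr)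
    show "(a \<otimes>\<^bsub>K\<^esub> b) \<odot>\<^bsub>V\<^esub> x = a \<odot>\<^bsub>V\<^esub> (b \<odot>\<^bsub>V\<^esub> x)" by (simp add: hom Li.smult_assoc1)
    show "\<one>\<^bsub>K\<^esub> \<odot>\<^bsub>V\<^esub> x = x" by (simp add: hom)
    show "bracket V (a \<odot>\<^bsub>V\<^esub> x) y = a \<odot>\<^bsub>V\<^esub> bracket V x y" by (simp add: hom Li.bracket_smult_left)
    show "bracket V x (a \<odot>\<^bsub>V\<^esub> y) = a \<odot>\<^bsub>V\<^esub> bracket V x y" by (simp add: hom Li.bracket_smult_right)
  qed
  have "abelian_group V"
    \<comment> \<open>Laws in fewer than three vectors are obtained by filling the remaining slots
      with zero.\<close>
    by (rule abelian_groupI[OF group(1)[OF _ _ zero_closed] zero_closed group(2)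
          group(3)[OF _ _ zero_closed] group(4)[OF _ zero_closed zero_closed]
          group(5)[OF _ zero_closed zero_closed]])
  then have "module K V"
    by (rule moduleI[OF L0.R.is_cring]) (simp_all add: scalars
        scalars(5)[OF L0.R.one_closed L0.R.one_closed _ zero_closed])
  then show ?thesis
    by (intro lie_algebra.intro vectorspace.intro lie_algebra_axioms.intro L0.field_axioms)
      (simp_all add: group(6-10) scalars(6,7))
qed

section \<open>The algebras gl(n) and their quotient\<close>

lemma gl_leaf_simps [simp]:
  "carrier (gl_leaf n) = carrier_mat n n"
  "\<zero>\<^bsub>gl_leaf n\<^esub> = 0\<^sub>m n n"
  "A \<oplus>\<^bsub>gl_leaf n\<^esub> B = A + B"
  "a \<odot>\<^bsub>gl_leaf n\<^esub> A = a \<cdot>\<^sub>m A"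
  "bracket (gl_leaf n) A B = A * B - B * A"
  by (simp_all add: gl_leaf_def module.defs lie_struct.defs module_mat_def)

lemma gl_sigma_simps [simp]:
  "carrier gl_sigma = Sigma_space"
  "\<zero>\<^bsub>gl_sigma\<^esub> = Pr (0\<^sub>m 1 1)"
  "X \<oplus>\<^bsub>gl_sigma\<^esub> Y = X \<boxplus> Y"
  "a \<odot>\<^bsub>gl_sigma\<^esub> X = sigma_smult a X"
  "bracket gl_sigma X Y = (X \<ltimes> Y) \<boxminus> (Y \<ltimes> X)"
  by (simp_all add: gl_sigma_def)

text \<open>Each double commutator expands into four triple products, and the resulting twelve
  cancel in pairs.\<close>

lemma mat_commutator_jacobi:
  fixes A B C :: "'a::comm_ring_1 mat"
  assumes "A \<in> carrier_mat n n" "B \<in> carrier_mat n n" "C \<in> carrier_mat n n"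
  shows "(A * (B * C - C * B) - (B * C - C * B) * A) + (B * (C * A - A * C) - (C * A - A * C) * B)
    + (C * (A * B - B * A) - (A * B - B * A) * C) = 0\<^sub>m n n"
proof -
  have *: "X * (Y * Z - Z * Y) - (Y * Z - Z * Y) * X
      = (X * Y * Z - X * Z * Y) - (Y * Z * X - Z * Y * X)"
    if "X \<in> carrier_mat n n" "Y \<in> carrier_mat n n" "Z \<in> carrier_mat n n" for X Y Z :: "'a mat"
    using that by (simp add: mult_minus_distrib_mat[of _ n n _ n] minus_mult_distrib_mat[of _ n n _ _ n])
  show ?thesis
    unfolding *[OF assms] *[OF assms(2,3,1)] *[OF assms(3,1,2)]
    \<comment> \<open>With \<open>index_mult_mat(1)\<close> deleted, entries of products stay
      unevaluated and cancel as atoms.\<close>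
    using assms by (intro eq_matI) (simp_all del: index_mult_mat(1))
qed

lemma lie_algebra_gl_leaf: "lie_algebra class_ring (gl_leaf n :: ('a::field, 'a mat) lie_struct)"
proof -
  have "abelian_group (gl_leaf n :: ('a, 'a mat) lie_struct)"
  proof (rule abelian_groupI)
    fix A :: "'a mat" assume "A \<in> carrier (gl_leaf n)"
    then show "\<exists>B\<in>carrier (gl_leaf n). B \<oplus>\<^bsub>gl_leaf n\<^esub> A = \<zero>\<^bsub>gl_leaf n\<^esub>"
      by (intro bexI[of _ "- A"]) auto
  qed (auto simp: comm_add_mat)
  then have "module class_ring (gl_leaf n :: ('a, 'a mat) lie_struct)"
    by (rule moduleI[OF class_cring.cring_axioms])
      (auto simp: add_smult_distrib_left_mat add_smult_distrib_right_mat)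
  moreover have "lie_algebra_axioms class_ring (gl_leaf n :: ('a, 'a mat) lie_struct)"
    by unfold_locales
      \<comment> \<open>The sizes in the distributive and scalar laws are fixed to \<open>n\<close>
        because the equations themselves do not reveal them.\<close>
      (auto simp: mat_commutator_jacobi add_mult_distrib_mat[of _ n n] mult_add_distrib_mat[of _ n n]
        mult_smult_assoc_mat[of _ n n] mult_smult_distrib[of _ n n] algebra_simps intro!: eq_matI)
  ultimately show ?thesis
    by (intro lie_algebra.intro vectorspace.intro class_field.field_axioms)
qed

lemma lie_algebra_gl_sigma: "lie_algebra class_ring (gl_sigma :: ('a::field, 'a mat set) lie_struct)"
proof (rule lie_algebra_directed_union[where I = "{1..}" and L = gl_leaf and p = Pr])
  show "lie_algebra class_ring (gl_leaf n :: ('a, 'a mat) lie_struct)" for n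
    by (rule lie_algebra_gl_leaf)
  fix n :: nat assume n: "n \<in> {1..}"
  \<comment> \<open>The zero matrix of every size is an expansion of the 1 by 1 zero, so all leaves
    have the same zero class.\<close>
  have "Pr (0\<^sub>m 1 1 :: 'a mat) = Pr (0\<^sub>m 1 1 \<otimes>\<^sub>K 1\<^sub>m n)"
    using n by (intro Pr_kronecker_one[symmetric]) (auto simp: square_mats_iff)
  then show "\<zero>\<^bsub>gl_sigma\<^esub> = Pr (\<zero>\<^bsub>gl_leaf n\<^esub> :: 'a mat)"
    by (simp add: kronecker_zero)
next
  fix X Y Z :: "'a mat set"
  assume "X \<in> carrier gl_sigma" "Y \<in> carrier gl_sigma" "Z \<in> carrier gl_sigma"
  then obtain n A B C where "n > 0" "A \<in> carrier_mat n n" "B \<in> carrier_mat n n" "C \<in> carrier_mat n n"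
    "X = Pr A" "Y = Pr B" "Z = Pr C"
    unfolding gl_sigma_simps by (rule common_representatives)
  then show "\<exists>n\<in>{1..}. {X, Y, Z} \<subseteq> Pr ` carrier (gl_leaf n :: ('a, 'a mat) lie_struct)"
    by (intro bexI[of _ n]) auto
\<comment> \<open>For the bracket, both products are computed in size \<open>n\<close> and then
  subtracted there, giving the class of the commutator.\<close>
qed (auto simp: Suc_le_eq Pr_in_Sigma_space carrier_mat_square_mats sigma_smult_Pr sigma_add_Pr sigma_mult_Pr
    sigma_minus_Pr)

lemma lie_algebra_hom_Pr:
  assumes "n > 0"
  shows "lie_algebra_hom class_ring (gl_leaf n) (gl_sigma :: ('a::field, 'a mat set) lie_struct) Pr"
proof -
  interpret V: lie_algebra class_ring "gl_leaf n :: ('a, 'a mat) lie_struct"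
    by (rule lie_algebra_gl_leaf)
  interpret W: lie_algebra class_ring "gl_sigma :: ('a, 'a mat set) lie_struct"
    by (rule lie_algebra_gl_sigma)
  show ?thesis
    by unfold_locales
      (use assms in \<open>auto simp: module_hom_def Pr_in_Sigma_space carrier_mat_square_mats
        sigma_smult_Pr sigma_add_Pr sigma_mult_Pr sigma_minus_Pr\<close>)
qed


section \<open>The bundle\<close>

text \<open>Such a set is a union of whole leaves, and each leaf is open in its own Euclidean
  topology.\<close>

lemma openin_matrix_topologyI:
  assumes "U \<subseteq> square_mats" "\<And>n. n > 0 \<Longrightarrow> U \<inter> carrier_mat n n = {} \<or> carrier_mat n n \<subseteq> U"
  shows "openin matrix_topology U"
  unfolding openin_matrix_topology
proof (intro conjI allI impI)
  fix n :: nat assume "1 \<le> n"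
  interpret Metric_space "carrier_mat n n" "mat_dist n :: 'a mat \<Rightarrow> 'a mat \<Rightarrow> real"
    by (rule Metric_space_mat)
  have "U \<inter> carrier_mat n n = {} \<or> U \<inter> carrier_mat n n = topspace mtopology"
    using assms(2)[of n] \<open>1 \<le> n\<close> by auto
  then show "openin mtopology (U \<inter> carrier_mat n n)"
    by (metis openin_empty openin_topspace)
qed (fact assms(1))

lemma topspace_matrix_topology [simp]: "topspace matrix_topology = square_mats"
proof (rule antisym)
  show "topspace matrix_topology \<subseteq> (square_mats :: 'a mat set)"
    by (metis openin_matrix_topology openin_topspace)
  show "square_mats \<subseteq> topspace (matrix_topology :: 'a mat topology)"
    by (intro openin_subset openin_matrix_topologyI) (auto intro: carrier_mat_square_mats)
qed

lemma openin_leaf: "n > 0 \<Longrightarrow> openin matrix_topology (carrier_mat n n)"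
  by (rule openin_matrix_topologyI) (auto intro: carrier_mat_square_mats)

lemma leaves_matrix_topology: "leaves matrix_topology {1..} (\<lambda>n. carrier_mat n n)"
  unfolding leaves_def
proof (intro conjI ballI)
  fix n :: nat assume n: "n \<in> {1..}"
  then show "openin matrix_topology (carrier_mat n n)" by (intro openin_leaf) auto
  \<comment> \<open>The complement of a leaf is the union of the other leaves, hence open.\<close>
  have "openin matrix_topology (square_mats - carrier_mat n n)"
    by (rule openin_matrix_topologyI) (auto intro: carrier_mat_square_mats)
  then show "closedin matrix_topology (carrier_mat n n)"
    using n by (auto simp: closedin_def intro: carrier_mat_square_mats)
qed (auto simp: square_mats_def disjoint_family_on_def)

text \<open>Discreteness concerns the topology that a fiber inherits from the total space, so
  \<open>B\<close> can be arbitrary and both topologies on the base are covered.\<close>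

lemma discrete_fibers_Pr: "discrete_fibers matrix_topology Pr B"
  unfolding discrete_fibers_def
proof
  fix X :: "'a mat set"
  let ?F = "fiber matrix_topology Pr X"
  have "openin (subtopology matrix_topology ?F) {A}" if A: "A \<in> ?F" for A
  proof -
    have sq: "A \<in> square_mats" "Pr A = X" using A by (simp_all add: fiber_def)
    then obtain n where n: "n > 0" and c: "A \<in> carrier_mat n n"
      by (auto simp: square_mats_def Suc_le_eq)
    have "B = A" if "B \<in> carrier_mat n n" "B \<in> ?F" for B
      using Pr_inj_on_leaf[OF that(1) c n] that(2) sq by (simp add: fiber_def)
    then have "{A} = carrier_mat n n \<inter> ?F" using A c by blast
    then show ?thesis using openin_leaf[OF n] unfolding openin_subtopology by blast
  qed
  moreover have "topspace (subtopology matrix_topology ?F) = ?F"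
    by (auto simp: fiber_def)
  ultimately show "subtopology matrix_topology ?F = discrete_topology ?F"
    by (intro discrete_topology_unique[THEN iffD2, symmetric] conjI ballI) auto
qed

section \<open>Topologies on the base\<close>

lemma topspace_sigma_topology: "topspace sigma_topology = Sigma_space"
proof (rule antisym)
  show "topspace sigma_topology \<subseteq> (Sigma_space :: 'a mat set set)"
    unfolding sigma_topology_def topology_generated_by_topspace by (auto simp: sigma_nbhd_def)
  show "Sigma_space \<subseteq> topspace (sigma_topology :: 'a mat set topology)"
  proof
    fix X :: "'a mat set" assume X: "X \<in> Sigma_space"
    then obtain n A where A: "n > 0" "A \<in> carrier_mat n n" "X = Pr A"
      using common_representatives by metis
    interpret Metric_space "carrier_mat n n" "mat_dist n :: 'a mat \<Rightarrow> 'a mat \<Rightarrow> real"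
      by (rule Metric_space_mat)
    \<comment> \<open>The sub-basis covers every class: a ball about the rational center zero, with
      rational radius beyond the distance to \<open>A\<close>, contains \<open>A\<close>.\<close>
    obtain r where r: "r \<in> \<rat>" "mat_dist n (0\<^sub>m n n) A < r"
      using Rats_dense_in_real[of "mat_dist n (0\<^sub>m n n) A" "mat_dist n (0\<^sub>m n n) A + 1"] by auto
    then have "A \<in> mball (0\<^sub>m n n) r" using A(2) by simp
    moreover have "r > 0" using le_less_trans[OF nonneg r(2)] .
    moreover have "A \<in> X" using A by (simp add: self_mem_Pr carrier_mat_square_mats)
    ultimately have "X \<in> sigma_nbhd (mball (0\<^sub>m n n) r)" "r > 0"
      using X by (auto simp: sigma_nbhd_def)
    moreover have "rational_mat n (0\<^sub>m n n :: 'a mat)"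
      by (simp add: rational_mat_def)
    ultimately show "X \<in> topspace sigma_topology"
      unfolding sigma_topology_def topology_generated_by_topspace
      using A(1) r(1) by (intro UnionI[of "sigma_nbhd (mball (0\<^sub>m n n) r)"]) (auto simp: Suc_le_eq)
  qed
qed

text \<open>Preimages commute with intersections and unions, so the defining predicate really is a
  topology and \<open>topology\<close> can be unfolded.\<close>

lemma openin_sigma_quotient_topology:
  "openin sigma_quotient_topology U \<longleftrightarrow>
    U \<subseteq> Sigma_space \<and> openin matrix_topology {A \<in> square_mats. Pr A \<in> U}"
proof -
  have "istopology (\<lambda>U :: 'a mat set set.
      U \<subseteq> Sigma_space \<and> openin matrix_topology {A \<in> square_mats. Pr A \<in> U})"
    unfolding istopology_def
  proof (intro conjI allI impI)
    fix S T :: "'a mat set set"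
    assume ST: "S \<subseteq> Sigma_space \<and> openin matrix_topology {A \<in> square_mats. Pr A \<in> S}"
      "T \<subseteq> Sigma_space \<and> openin matrix_topology {A \<in> square_mats. Pr A \<in> T}"
    then show "S \<inter> T \<subseteq> Sigma_space" by blast
    have "{A \<in> square_mats. Pr A \<in> S \<inter> T} =
        {A \<in> square_mats. Pr A \<in> S} \<inter> {A \<in> square_mats. Pr A \<in> T}" by blast
    then show "openin matrix_topology {A \<in> square_mats. Pr A \<in> S \<inter> T}"
      using ST by (simp add: openin_Int)
  next
    fix \<K> :: "'a mat set set set"
    assume K: "\<forall>K\<in>\<K>. K \<subseteq> Sigma_space \<and> openin matrix_topology {A \<in> square_mats. Pr A \<in> K}"
    then show "\<Union>\<K> \<subseteq> Sigma_space" by blast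
    have "{A \<in> square_mats. Pr A \<in> \<Union>\<K>} = (\<Union>K\<in>\<K>. {A \<in> square_mats. Pr A \<in> K})" by blast
    then show "openin matrix_topology {A \<in> square_mats. Pr A \<in> \<Union>\<K>}"
      using K by (auto simp only: intro!: openin_Union)
  qed
  then show ?thesis
    by (simp add: sigma_quotient_topology_def topology_inverse')
qed

lemma topspace_sigma_quotient_topology: "topspace sigma_quotient_topology = Sigma_space"
proof (rule antisym)
  show "topspace sigma_quotient_topology \<subseteq> (Sigma_space :: 'a mat set set)"
    using openin_sigma_quotient_topology openin_topspace by blast
  have "{A \<in> square_mats. Pr A \<in> Sigma_space} = (square_mats :: 'a mat set)"
    by (auto intro: Pr_in_Sigma_space)
  moreover have "openin matrix_topology (square_mats :: 'a mat set)"
    using openin_topspace[of matrix_topology] by simp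
  ultimately have "openin sigma_quotient_topology (Sigma_space :: 'a mat set set)"
    unfolding openin_sigma_quotient_topology by simp
  then show "Sigma_space \<subseteq> topspace (sigma_quotient_topology :: 'a mat set topology)"
    by (rule openin_subset)
qed

lemma top_bundle_Pr: "top_bundle matrix_topology Pr sigma_quotient_topology"
  unfolding top_bundle_def continuous_map_def
  by (auto simp: topspace_sigma_quotient_topology openin_sigma_quotient_topology Pr_in_Sigma_space)

text \<open>The topology on the base enters the Lie part only through its underlying set, so one
  statement serves both topologies.\<close>

lemma bundled_lie_structure_gl:
  fixes B :: "'a::{euclidean_space, real_normed_field} mat set topology"
  assumes "topspace B = Sigma_space"
  shows "bundled_lie_structure class_ring matrix_topology Pr B {1..} gl_leaf gl_sigma"
  unfolding bundled_lie_structure_def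
  using assms leaves_matrix_topology
  by (auto intro: lie_algebra_gl_sigma lie_algebra_gl_leaf lie_algebra_hom_Pr)

text \<open>By \<open>not_bundle_sigma_topology\<close>, \<open>Pr\<close> is not continuous into
  \<open>sigma_topology\<close>. For that topology the claims are therefore discrete fibers and the
  Lie structure; the full bundled Lie algebra, continuity included, is claimed for the quotient
  topology. Each is stated over the reals and over the complex numbers.\<close>

theorem theorem148:
  shows
    "discrete_fibers matrix_topology Pr (sigma_topology :: real mat set topology) \<and>
     bundled_lie_structure class_ring matrix_topology Pr (sigma_topology :: real mat set topology)
       {1..} gl_leaf gl_sigma \<and>
     bundled_lie_algebra class_ring matrix_topology Pr
       (sigma_quotient_topology :: real mat set topology) {1..} gl_leaf gl_sigma \<and>
     discrete_fibers matrix_topology Pr (sigma_topology :: complex mat set topology) \<and>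
     bundled_lie_structure class_ring matrix_topology Pr (sigma_topology :: complex mat set topology)
       {1..} gl_leaf gl_sigma \<and>
     bundled_lie_algebra class_ring matrix_topology Pr
       (sigma_quotient_topology :: complex mat set topology) {1..} gl_leaf gl_sigma"
  unfolding bundled_lie_algebra_def discrete_bundle_def
  by (intro conjI discrete_fibers_Pr top_bundle_Pr bundled_lie_structure_gl
      topspace_sigma_topology topspace_sigma_quotient_topology)

end
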